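(* Let $A\in\mathbb{R}^{m\times n}$ with $m<n$, $\boldsymbol b\in\mathbb{R}^m$ with $\boldsymbol b\ne\mathbf 0$, and $\mu>0$. Assume that every submatrix of $A$ formed by $n-1$ of its columns has full row rank. Then any optimal solution $\widehat{\boldsymbol x}\in\mathbb{R}^n$ of $$\min_{\boldsymbol x\in\mathbb{R}^n,\ A\boldsymbol x=\boldsymbol b}\Phi_\mu(\boldsymbol x)$$ satisfies $|\widehat{\boldsymbol x}_i|\neq\mu$ for all $i=1,\dots,n$, and $\Phi_\mu$ is differentiable in a neighborhood of $\widehat{\boldsymbol x}$.
   Context: The truncated Huber function with parameter $\mu>0$ is $\phi_\mu(x)=\min(1,x^2/\mu^2)$ for $x\in\mathbb{R}$, and $\Phi_\mu(\boldsymbol x)=\sum_{i=1}^n\phi_\mu(\boldsymbol x_i)$ for $\boldsymbol x\in\mathbb{R}^n$. *)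

theory Defs
  imports "HOL-Analysis.Analysis"
begin

definition trunc_huber :: "real \<Rightarrow> real \<Rightarrow> real" where
  "trunc_huber \<mu> x = min 1 (x\<^sup>2 / \<mu>\<^sup>2)"

definition trunc_huber_sum :: "real \<Rightarrow> real ^ 'n \<Rightarrow> real" where
  "trunc_huber_sum \<mu> x = (\<Sum>i\<in>UNIV. trunc_huber \<mu> (x $ i))"

(* Column j of col_submatrix A e is column e j of A.  For injective e this is the submatrix
   formed by the CARD('k) distinct columns in the range of e; all orders in which those
   columns can be listed occur, which does not affect the rank. *)
definition col_submatrix :: "real ^ 'n ^ 'm \<Rightarrow> ('k \<Rightarrow> 'n) \<Rightarrow> real ^ 'k ^ 'm" where
  "col_submatrix A e = (\<chi> i j. A $ i $ e j)"

end

theory Submission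
  imports Defs
begin

text \<open>
  At \<open>\<plusminus>\<mu>\<close> the function \<open>\<phi>\<^sub>\<mu>\<close> is the minimum of two smooth functions that cross with different
  slopes, so it has a concave kink there. A local minimiser on a line cannot sit at such a kink:
  along a direction \<open>h\<close> the symmetric second difference of \<open>\<Phi>\<^sub>\<mu>\<close> with step \<open>t\<close> is at most
  \<open>2t\<^sup>2\<parallel>h\<parallel>\<^sup>2/\<mu>\<^sup>2\<close>, because no summand curves upwards more than the parabola does
  (\<open>trunc_huber_second_difference\<close>), and a kink at coordinate \<open>i\<close> lowers this bound by
  \<open>2t\<bar>h\<^sub>i\<bar>/\<mu>\<close>, a term of first order in \<open>t\<close> (\<open>trunc_huber_second_difference_kink\<close>). For small \<open>t\<close>
  the second difference is negative as soon as \<open>h\<^sub>i \<noteq> 0\<close>, whereas at a minimiser over an affine space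
  it is nonnegative for every direction \<open>h\<close> of that space.

  The rank hypothesis supplies the direction: the columns of \<open>A\<close> other than column \<open>i\<close> still span
  the whole space, so column \<open>i\<close> is a combination of them, and this linear relation is a kernel
  vector of \<open>A\<close> with \<open>h\<^sub>i = 1\<close> (\<open>kernel_vector_of_remaining_columns\<close>). Hence no coordinate of a
  minimiser has absolute value \<open>\<mu>\<close>. The points with this property form an open set, on which every
  summand is locally either the parabola or a constant.
\<close>

section \<open>Second differences of the truncated Huber function\<close>

text \<open>
  If the minimum defining \<open>\<phi>\<^sub>\<mu>(x)\<close> is attained by the constant, both neighbouring values are at most
  that constant; if it is attained by the parabola, they are at most the values of the parabola,
  whose second difference is exactly the right-hand side.
\<close>
lemma trunc_huber_second_difference:
  "trunc_huber \<mu> (x + t) + trunc_huber \<mu> (x - t) - 2 * trunc_huber \<mu> x \<le> 2 * t\<^sup>2 / \<mu>\<^sup>2"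
proof -
  have le_one: "trunc_huber \<mu> y \<le> 1" and le_parabola: "trunc_huber \<mu> y \<le> y\<^sup>2 / \<mu>\<^sup>2" for y
    by (simp_all add: trunc_huber_def)
  have parabola: "(x + t)\<^sup>2 / \<mu>\<^sup>2 + (x - t)\<^sup>2 / \<mu>\<^sup>2 = 2 * (x\<^sup>2 / \<mu>\<^sup>2) + 2 * t\<^sup>2 / \<mu>\<^sup>2"
    by (simp add: power2_eq_square algebra_simps add_divide_distrib diff_divide_distrib)
  have nonneg: "0 \<le> 2 * t\<^sup>2 / \<mu>\<^sup>2"
    by simp
  consider "trunc_huber \<mu> x = 1" | "trunc_huber \<mu> x = x\<^sup>2 / \<mu>\<^sup>2"
    unfolding trunc_huber_def by linarith
  then show ?thesis
  proof cases
    case 1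
    then show ?thesis
      using le_one[of "x + t"] le_one[of "x - t"] nonneg by linarith
  next
    case 2
    then show ?thesis
      using le_parabola[of "x + t"] le_parabola[of "x - t"] parabola by linarith
  qed
qed

text \<open>
  Of the two points \<open>x \<plusminus> t\<close>, one lies on the side of the origin, where the parabola bounds the value
  by \<open>(\<mu> - \<bar>t\<bar>)\<^sup>2/\<mu>\<^sup>2\<close>; at the other the constant 1 is used. The coefficient of \<open>t\<^sup>2\<close>
  obtained in this way is 1; it is relaxed to 2 to combine directly with the general bound.
\<close>
lemma trunc_huber_second_difference_kink:
  assumes "\<mu> > 0" and "\<bar>x\<bar> = \<mu>"
  shows "trunc_huber \<mu> (x + t) + trunc_huber \<mu> (x - t) - 2 * trunc_huber \<mu> x
    \<le> 2 * t\<^sup>2 / \<mu>\<^sup>2 - 2 * \<bar>t\<bar> / \<mu>"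
proof -
  have le_one: "trunc_huber \<mu> y \<le> 1" and le_parabola: "trunc_huber \<mu> y \<le> y\<^sup>2 / \<mu>\<^sup>2" for y
    by (simp_all add: trunc_huber_def)
  have "x\<^sup>2 = \<mu>\<^sup>2"
    using assms(2) by (metis power2_abs)
  then have at_x: "trunc_huber \<mu> x = 1"
    using assms(1) by (simp add: trunc_huber_def)
  have inner: "(\<mu> - \<bar>t\<bar>)\<^sup>2 / \<mu>\<^sup>2 = 1 - 2 * \<bar>t\<bar> / \<mu> + t\<^sup>2 / \<mu>\<^sup>2"
    using assms(1) by (simp add: power2_eq_square field_simps)
  have "(x + t)\<^sup>2 = (\<mu> - \<bar>t\<bar>)\<^sup>2 \<or> (x - t)\<^sup>2 = (\<mu> - \<bar>t\<bar>)\<^sup>2"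
    using assms by (auto simp: power2_eq_iff abs_if split: if_splits)
  then have "trunc_huber \<mu> (x + t) \<le> (\<mu> - \<bar>t\<bar>)\<^sup>2 / \<mu>\<^sup>2 \<or> trunc_huber \<mu> (x - t) \<le> (\<mu> - \<bar>t\<bar>)\<^sup>2 / \<mu>\<^sup>2"
    using le_parabola by metis
  moreover have "0 \<le> t\<^sup>2 / \<mu>\<^sup>2" "2 * t\<^sup>2 / \<mu>\<^sup>2 = t\<^sup>2 / \<mu>\<^sup>2 + t\<^sup>2 / \<mu>\<^sup>2"
    by simp_all
  ultimately show ?thesis
    using le_one[of "x + t"] le_one[of "x - t"] at_x inner by linarith
qed

lemma trunc_huber_sum_second_difference_kink:
  fixes x h :: "real ^ 'n"
  assumes "\<mu> > 0" and "\<bar>x $ i\<bar> = \<mu>"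
  shows "trunc_huber_sum \<mu> (x + t *\<^sub>R h) + trunc_huber_sum \<mu> (x - t *\<^sub>R h) - 2 * trunc_huber_sum \<mu> x
    \<le> 2 * t\<^sup>2 * (norm h)\<^sup>2 / \<mu>\<^sup>2 - 2 * \<bar>t * h $ i\<bar> / \<mu>"
proof -
  have "trunc_huber_sum \<mu> (x + t *\<^sub>R h) + trunc_huber_sum \<mu> (x - t *\<^sub>R h) - 2 * trunc_huber_sum \<mu> x
    = (\<Sum>j\<in>UNIV. trunc_huber \<mu> (x $ j + t * h $ j) + trunc_huber \<mu> (x $ j - t * h $ j)
        - 2 * trunc_huber \<mu> (x $ j))"
    by (simp add: trunc_huber_sum_def sum.distrib sum_subtractf sum_distrib_left)
  also have "\<dots> \<le> (\<Sum>j\<in>UNIV. 2 * (t * h $ j)\<^sup>2 / \<mu>\<^sup>2 - (if j = i then 2 * \<bar>t * h $ j\<bar> / \<mu> else 0))"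
    by (intro sum_mono)
      (use trunc_huber_second_difference trunc_huber_second_difference_kink[OF assms] in auto)
  also have "\<dots> = (\<Sum>j\<in>UNIV. 2 * t\<^sup>2 / \<mu>\<^sup>2 * (h $ j)\<^sup>2) - 2 * \<bar>t * h $ i\<bar> / \<mu>"
    by (simp add: sum_subtractf power_mult_distrib algebra_simps)
  also have "(\<Sum>j\<in>UNIV. 2 * t\<^sup>2 / \<mu>\<^sup>2 * (h $ j)\<^sup>2) = 2 * t\<^sup>2 * (norm h)\<^sup>2 / \<mu>\<^sup>2"
    by (simp add: norm_vec_def L2_set_def sum_nonneg sum_distrib_left sum_divide_distrib)
  finally show ?thesis .
qed

text \<open>
  For small \<open>t\<close> the first-order gain at the kink outweighs the second-order loss elsewhere, so one
  of the two points \<open>x \<plusminus> th\<close> has a smaller value than \<open>x\<close>.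
\<close>
lemma trunc_huber_sum_decreases_at_kink:
  fixes x h :: "real ^ 'n"
  assumes "\<mu> > 0" and "\<bar>x $ i\<bar> = \<mu>" and "h $ i \<noteq> 0"
  obtains t where "trunc_huber_sum \<mu> (x + t *\<^sub>R h) < trunc_huber_sum \<mu> x"
proof -
  \<comment> \<open>The bound \<open>2t\<^sup>2\<parallel>h\<parallel>\<^sup>2/\<mu>\<^sup>2 - 2t\<bar>h\<^sub>i\<bar>/\<mu>\<close> is negative for \<open>0 < t < \<mu>\<bar>h\<^sub>i\<bar>/\<parallel>h\<parallel>\<^sup>2\<close> and smallest at
    the midpoint of this interval.\<close>
  define t where "t = \<mu> * \<bar>h $ i\<bar> / (2 * (norm h)\<^sup>2)"
  have "norm h > 0"
    using assms(3) by auto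
  then have "2 * t\<^sup>2 * (norm h)\<^sup>2 / \<mu>\<^sup>2 - 2 * \<bar>t * h $ i\<bar> / \<mu> = - ((h $ i)\<^sup>2 / (2 * (norm h)\<^sup>2))"
    using assms(1) unfolding t_def by (simp add: abs_mult field_simps power2_eq_square)
  also have "\<dots> < 0"
    using \<open>norm h > 0\<close> assms(3) by simp
  finally have "trunc_huber_sum \<mu> (x + t *\<^sub>R h) + trunc_huber_sum \<mu> (x - t *\<^sub>R h)
      < 2 * trunc_huber_sum \<mu> x"
    using trunc_huber_sum_second_difference_kink[OF assms(1,2), of t h] by linarith
  then have "trunc_huber_sum \<mu> (x + t *\<^sub>R h) < trunc_huber_sum \<mu> x
      \<or> trunc_huber_sum \<mu> (x + (- t) *\<^sub>R h) < trunc_huber_sum \<mu> x"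
    by auto
  then show thesis
    using that by blast
qed

section \<open>A kernel vector from the rank condition\<close>

lemma col_submatrix_mult:
  fixes A :: "real ^ 'n ^ 'm" and e :: "'k::finite \<Rightarrow> 'n" and y :: "real ^ 'k"
  assumes "inj e"
  shows "col_submatrix A e *v y = A *v (\<chi> j. if j \<in> range e then y $ inv e j else 0)"
proof -
  have "(\<Sum>k\<in>UNIV. A $ r $ e k * y $ k)
      = (\<Sum>j\<in>UNIV. A $ r $ j * (if j \<in> range e then y $ inv e j else 0))" for r
  proof -
    have "(\<Sum>k\<in>UNIV. A $ r $ e k * y $ k) = (\<Sum>j\<in>range e. A $ r $ j * y $ inv e j)"
      using assms by (simp add: sum.reindex)
    also have "\<dots> = (\<Sum>j\<in>UNIV. A $ r $ j * (if j \<in> range e then y $ inv e j else 0))"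
      by (rule sum.mono_neutral_cong_left) auto
    finally show ?thesis .
  qed
  then show ?thesis
    by (simp add: vec_eq_iff matrix_vector_mult_def col_submatrix_def)
qed

text \<open>
  Full row rank makes the columns selected by \<open>e\<close> span the whole space, so column \<open>i\<close> is a linear
  combination of them; the difference of the two sides is the kernel vector.
\<close>
lemma kernel_vector_of_remaining_columns:
  fixes A :: "real ^ 'n ^ 'm" and e :: "'k::finite \<Rightarrow> 'n"
  assumes "inj e" and "i \<notin> range e" and "rank (col_submatrix A e) = CARD('m)"
  obtains h where "A *v h = 0" and "h $ i = 1"
proof -
  have "surj ((*v) (col_submatrix A e))"
    using assms(3) by (simp add: full_rank_surjective)
  then obtain y where y: "col_submatrix A e *v y = A *v axis i 1"
    by (metis surjD)
  define z :: "real ^ 'n" where "z = (\<chi> j. if j \<in> range e then y $ inv e j else 0)"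
  have "A *v (axis i 1 - z) = 0"
    using y col_submatrix_mult[OF assms(1), of A y]
    by (simp add: z_def matrix_vector_mult_diff_distrib)
  moreover have "(axis i 1 - z) $ i = 1"
    using assms(2) by (simp add: z_def)
  ultimately show thesis
    using that by blast
qed

lemma ex_inj_omitting:
  fixes i :: "'n::finite"
  assumes "CARD('k::finite) = CARD('n) - 1"
  obtains e :: "'k::finite \<Rightarrow> 'n" where "inj e" and "i \<notin> range e"
proof -
  have "card (UNIV :: 'k set) = card (UNIV - {i})"
    using assms by (simp add: card_Diff_singleton)
  then obtain e :: "'k \<Rightarrow> 'n" where "bij_betw e UNIV (UNIV - {i})"
    using finite_same_card_bij[of "UNIV :: 'k set" "UNIV - {i}"] by auto
  then show thesis
    using that unfolding bij_betw_def by blast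
qed

section \<open>Differentiability away from the kinks\<close>

lemma trunc_huber_differentiable:
  assumes "\<mu> > 0" and "\<bar>x\<bar> \<noteq> \<mu>"
  shows "trunc_huber \<mu> differentiable (at x)"
proof (cases "\<bar>x\<bar> < \<mu>")
  case True
  have "trunc_huber \<mu> y = y\<^sup>2 / \<mu>\<^sup>2" if "y \<in> {-\<mu><..<\<mu>}" for y
  proof -
    have "y\<^sup>2 \<le> \<mu>\<^sup>2"
      using that by (auto simp flip: abs_le_square_iff)
    then show ?thesis
      using assms(1) by (simp add: trunc_huber_def min_def)
  qed
  moreover have "((\<lambda>y. y\<^sup>2 / \<mu>\<^sup>2) has_field_derivative (2 * x / \<mu>\<^sup>2)) (at x)"
    by (rule DERIV_cdivide) (auto intro!: derivative_eq_intros)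
  moreover have "x \<in> {-\<mu><..<\<mu>}"
    using True by auto
  ultimately have "(trunc_huber \<mu> has_field_derivative (2 * x / \<mu>\<^sup>2)) (at x)"
    using has_field_derivative_transform_within_open[of "\<lambda>y. y\<^sup>2 / \<mu>\<^sup>2" _ x "{-\<mu><..<\<mu>}"]
    by fastforce
  then show ?thesis
    using has_field_derivative_imp_has_derivative differentiableI by blast
next
  case False
  have "trunc_huber \<mu> y = 1" if "y \<in> {y. \<mu> < \<bar>y\<bar>}" for y
  proof -
    have "\<mu>\<^sup>2 \<le> y\<^sup>2"
      using that assms(1) by (simp flip: abs_le_square_iff)
    then show ?thesis
      using assms(1) by (simp add: trunc_huber_def min_def)
  qed
  moreover have "open {y::real. \<mu> < \<bar>y\<bar>}"
    by (intro open_Collect_less continuous_intros)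
  moreover have "x \<in> {y. \<mu> < \<bar>y\<bar>}"
    using False assms(2) by auto
  moreover have "((\<lambda>y. 1) has_field_derivative 0) (at x)"
    by simp
  ultimately have "(trunc_huber \<mu> has_field_derivative 0) (at x)"
    using has_field_derivative_transform_within_open[of "\<lambda>y. 1" 0 x "{y. \<mu> < \<bar>y\<bar>}" "trunc_huber \<mu>"]
    by presburger
  then show ?thesis
    using has_field_derivative_imp_has_derivative differentiableI by blast
qed

lemma trunc_huber_sum_differentiable:
  fixes x :: "real ^ 'n"
  assumes "\<mu> > 0" and "\<And>i. \<bar>x $ i\<bar> \<noteq> \<mu>"
  shows "trunc_huber_sum \<mu> differentiable (at x)"
proof -
  have "(\<lambda>x. trunc_huber \<mu> (x $ i)) differentiable (at x)" for i
  proof -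
    have "(\<lambda>x::real^'n. x $ i) differentiable (at x)"
      by (simp add: bounded_linear_imp_differentiable bounded_linear_vec_nth)
    then have "(trunc_huber \<mu> \<circ> (\<lambda>x. x $ i)) differentiable (at x)"
      using differentiable_chain_at trunc_huber_differentiable[OF assms(1) assms(2)[of i]] by blast
    then show ?thesis
      by (simp add: o_def)
  qed
  then have "(\<lambda>x. \<Sum>i\<in>UNIV. trunc_huber \<mu> (x $ i)) differentiable (at x)"
    by (intro differentiable_sum) auto
  then show ?thesis
    by (simp add: trunc_huber_sum_def[abs_def])
qed

section \<open>Optimal solutions avoid the kinks\<close>

theorem theorem2p5:
  fixes A :: "real ^ 'n ^ 'm" and b :: "real ^ 'm" and \<mu> :: real and xhat :: "real ^ 'n"
  assumes "CARD('m) < CARD('n)"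
    and "b \<noteq> 0"
    and "\<mu> > 0"
    and "CARD('k::finite) = CARD('n) - 1"
    and "\<And>e :: 'k \<Rightarrow> 'n. inj e \<Longrightarrow> rank (col_submatrix A e) = CARD('m)"
    and "is_arg_min (trunc_huber_sum \<mu>) (\<lambda>x. A *v x = b) xhat"
  shows "(\<forall>i. \<bar>xhat $ i\<bar> \<noteq> \<mu>) \<and>
    (\<exists>U. open U \<and> xhat \<in> U \<and> (\<forall>x\<in>U. trunc_huber_sum \<mu> differentiable (at x)))"
proof -
  have off_kink: "\<bar>xhat $ i\<bar> \<noteq> \<mu>" for i
  proof
    assume kink: "\<bar>xhat $ i\<bar> = \<mu>"
    obtain e :: "'k \<Rightarrow> 'n" where "inj e" "i \<notin> range e"
      using ex_inj_omitting[OF assms(4)] by blast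
    then obtain h where h: "A *v h = 0" "h $ i = 1"
      using kernel_vector_of_remaining_columns assms(5) by blast
    then have "h $ i \<noteq> 0"
      by simp
    then obtain t where "trunc_huber_sum \<mu> (xhat + t *\<^sub>R h) < trunc_huber_sum \<mu> xhat"
      using trunc_huber_sum_decreases_at_kink[OF assms(3) kink] by blast
    moreover have "A *v (xhat + t *\<^sub>R h) = b"
      using assms(6) h(1)
      by (simp add: is_arg_min_def matrix_vector_right_distrib matrix_vector_mult_scaleR)
    ultimately show False
      using assms(6) by (auto simp: is_arg_min_def)
  qed
  define U where "U = {x :: real ^ 'n. \<forall>i. \<bar>x $ i\<bar> \<noteq> \<mu>}"
  have "open {x :: real ^ 'n. \<bar>x $ i\<bar> \<noteq> \<mu>}" for i
    by (rule open_Collect_neq; intro continuous_intros)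
  then have "open U"
    unfolding U_def Collect_all_eq by auto
  moreover have "xhat \<in> U"
    using off_kink by (simp add: U_def)
  moreover have "\<forall>x\<in>U. trunc_huber_sum \<mu> differentiable (at x)"
    unfolding U_def by (auto intro: trunc_huber_sum_differentiable[OF assms(3)])
  ultimately show ?thesis
    using off_kink by blast
qed

end
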